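(* Let $\underline{\mathcal{A}}=(\underline{a}_{ijkl})$ and $\overline{\mathcal{A}}=(\overline{a}_{ijkl})$ be symmetric real $4$th order $3$-dimensional tensors with $\underline{\mathcal{A}}\le\overline{\mathcal{A}}$, and let $\mathcal{A}^I=[\underline{\mathcal{A}},\overline{\mathcal{A}}]$. Suppose $\underline{a}_{1111}=\underline{a}_{2222}=\underline{a}_{3333}=1$. Then $\mathcal{A}^I$ is positive definite if $\underline{a}_{1222}=\underline{a}_{2333}=\underline{a}_{1113}=\overline{a}_{1222}=\overline{a}_{2333}=\overline{a}_{1113}=0$, $\underline{a}_{1112}=\underline{a}_{2223}=-1$, $\overline{a}_{1112}=\overline{a}_{2223}=1$, and one of the following conditions is satisfied: (a) $\underline{a}_{iijj}=\frac23$ and $\underline{a}_{iijk}=\overline{a}_{iijk}=0$ for all pairwise distinct $i,j,k\in\{1,2,3\}$, and $\underline{a}_{1333}=-1$, $\overline{a}_{1333}=1$; (b) $\underline{a}_{iijj}=1$ for all $i,j\in\{1,2,3\}$, $i\ne j$, $\underline{a}_{1123}=\underline{a}_{1223}=\overline{a}_{1123}=\overline{a}_{1223}=0$, $\underline{a}_{1233}=-1$, $\overline{a}_{1233}=1$, and $\underline{a}_{1333}=\overline{a}_{1333}=0$.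
   Context: A tensor $\mathcal{A}=(a_{ijkl})$, $i,j,k,l\in\{1,2,3\}$, is symmetric if its entries are invariant under all permutations of the indices (so a condition on one entry applies to all entries with permuted indices). Inequalities between tensors are entrywise, and $[\underline{\mathcal{A}},\overline{\mathcal{A}}]$ is the set of all real $4$th order $3$-dimensional tensors $\mathcal{A}$ with $\underline{\mathcal{A}}\le\mathcal{A}\le\overline{\mathcal{A}}$ (interval tensor). A tensor $\mathcal{A}$ is positive definite if $\mathcal{A}x^4=\sum_{i,j,k,l=1}^3a_{ijkl}x_ix_jx_kx_l>0$ for all $x\in\mathbb{R}^3\setminus\{0\}$. An interval tensor is positive definite if every tensor in it is. *)

theory Defs
  imports "HOL-Analysis.Analysis" "HOL-Combinatorics.Permutations"
begin

text \<open>A fourth-order tensor with index type \<open>'n\<close>; \<open>A $ i $ j $ k $ l\<close> is the entry $a_{ijkl}$.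
  For \<open>'n = 3\<close> the indices are \<open>1, 2, 3 :: 3\<close>. The library order on vectors is componentwise, so
  \<open>\<le>\<close> on tensors is the entrywise order and \<open>{L..U}\<close> is the interval tensor $[L, U]$, which
  contains non-symmetric tensors even when \<open>L\<close> and \<open>U\<close> are symmetric.\<close>

type_synonym 'n tensor4 = "real ^ 'n ^ 'n ^ 'n ^ 'n"

definition symmetric_tensor :: "'n::finite tensor4 \<Rightarrow> bool" where
  "symmetric_tensor A \<longleftrightarrow>
     (\<forall>\<sigma> (i :: nat \<Rightarrow> 'n). \<sigma> permutes {1..4} \<longrightarrow>
        A $ i (\<sigma> 1) $ i (\<sigma> 2) $ i (\<sigma> 3) $ i (\<sigma> 4) = A $ i 1 $ i 2 $ i 3 $ i 4)"

definition tensor_form :: "'n::finite tensor4 \<Rightarrow> real ^ 'n \<Rightarrow> real" where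
  "tensor_form A x =
     (\<Sum>i\<in>UNIV. \<Sum>j\<in>UNIV. \<Sum>k\<in>UNIV. \<Sum>l\<in>UNIV. A $ i $ j $ k $ l * x $ i * x $ j * x $ k * x $ l)"

definition pos_def_tensor :: "'n::finite tensor4 \<Rightarrow> bool" where
  "pos_def_tensor A \<longleftrightarrow> (\<forall>x. x \<noteq> 0 \<longrightarrow> tensor_form A x > 0)"

definition pos_def_interval_tensor :: "'n::finite tensor4 set \<Rightarrow> bool" where
  "pos_def_interval_tensor S \<longleftrightarrow> (\<forall>A\<in>S. pos_def_tensor A)"

end

theory Submission imports Defs begin

text \<open>
  Among all tensors of the interval the form is smallest, at a given point \<open>x\<close>, when every entry is
  chosen according to the sign of the monomial it multiplies. Here only two kinds of monomials occur.
  Squares of quadratic monomials are never negative, so their worst entry is the lower one. Every other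
  entry ranges over an interval \<open>[-c, c]\<close> (with \<open>c = 0\<close> or \<open>c = 1\<close>), so the least contribution is
  \<open>-c\<close> times the absolute value of the monomial. Both kinds together say that the form of any tensor
  in the interval, at \<open>x\<close>, is at least the form of the lower tensor \<open>L\<close> at the vector of absolute
  values of \<open>x\<close> (\<open>tensor_form_lower_bound\<close>). Hence it suffices that the single tensor \<open>L\<close> is
  positive definite (\<open>pos_def_interval_if_lower_pos_def\<close>).

  By symmetry the form of \<open>L\<close> is an explicit ternary quartic. A nonnegative ternary quartic is a sum of
  squares of quadratic forms by Hilbert's theorem, and for both conditions such a representation with
  small rational coefficients exists (\<open>cyclic_quartic_pos\<close> and \<open>noncyclic_quartic_pos\<close>).
\<close>

section \<open>Reduction to the lower tensor\<close>

text \<open>The monomial \<open>x\<^sub>i x\<^sub>j x\<^sub>k x\<^sub>l\<close> is a square exactly when its indices fall into two equal pairs.\<close>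

definition paired :: "'a \<Rightarrow> 'a \<Rightarrow> 'a \<Rightarrow> 'a \<Rightarrow> bool" where
  "paired i j k l \<longleftrightarrow> (i = j \<and> k = l) \<or> (i = k \<and> j = l) \<or> (i = l \<and> j = k)"

lemma paired_monomial_nonneg:
  fixes x :: "real ^ 'n"
  assumes "paired i j k l"
  shows "0 \<le> x$i * x$j * x$k * x$l"
proof -
  obtain p q where "x$i * x$j * x$k * x$l = (x$p * x$q)\<^sup>2"
    using assms unfolding paired_def by (auto simp: power2_eq_square ac_simps)
  then show ?thesis
    by simp
qed

lemma tensor_form_lower_bound:
  fixes L U A :: "'n::finite tensor4"
  assumes A: "A \<in> {L..U}"
    and opposite: "\<And>i j k l. \<not> paired i j k l \<Longrightarrow> U$i$j$k$l = - L$i$j$k$l"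
  shows "tensor_form L (\<chi> i. \<bar>x$i\<bar>) \<le> tensor_form A x"
proof -
  have "L$i$j$k$l * \<bar>x$i\<bar> * \<bar>x$j\<bar> * \<bar>x$k\<bar> * \<bar>x$l\<bar> \<le> A$i$j$k$l * x$i * x$j * x$k * x$l"
    for i j k l
  proof -
    define m where "m = x$i * x$j * x$k * x$l"
    have bounds: "L$i$j$k$l \<le> A$i$j$k$l" "A$i$j$k$l \<le> U$i$j$k$l"
      using A by (auto simp: less_eq_vec_def)
    have "L$i$j$k$l * \<bar>m\<bar> \<le> A$i$j$k$l * m"
    proof (cases "paired i j k l")
      case True
      then show ?thesis
        using paired_monomial_nonneg[of i j k l x] bounds by (simp add: m_def mult_right_mono)
    next
      case False
      then have "\<bar>A$i$j$k$l\<bar> \<le> - L$i$j$k$l"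
        using bounds opposite[of i j k l] by auto
      then have "\<bar>A$i$j$k$l * m\<bar> \<le> - L$i$j$k$l * \<bar>m\<bar>"
        unfolding abs_mult by (rule mult_right_mono) simp
      then show ?thesis
        by linarith
    qed
    then show ?thesis
      by (simp add: m_def abs_mult mult.assoc)
  qed
  then show ?thesis
    unfolding tensor_form_def by (auto intro!: sum_mono)
qed

lemma pos_def_interval_if_lower_pos_def:
  fixes L U :: "'n::finite tensor4"
  assumes L: "pos_def_tensor L"
    and opposite: "\<And>i j k l. \<not> paired i j k l \<Longrightarrow> U$i$j$k$l = - L$i$j$k$l"
  shows "pos_def_interval_tensor {L..U}"
  unfolding pos_def_interval_tensor_def pos_def_tensor_def
proof (intro ballI allI impI)
  fix A :: "'n tensor4" and x :: "real ^ 'n"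
  assume A: "A \<in> {L..U}" and "x \<noteq> 0"
  then have "(\<chi> i. \<bar>x$i\<bar>) \<noteq> 0"
    by (simp add: vec_eq_iff)
  then have "0 < tensor_form L (\<chi> i. \<bar>x$i\<bar>)"
    using L unfolding pos_def_tensor_def by blast
  also have "\<dots> \<le> tensor_form A x"
    using A opposite by (rule tensor_form_lower_bound)
  finally show "0 < tensor_form A x" .
qed

section \<open>Symmetric tensors of dimension three\<close>

text \<open>Adjacent transpositions generate all permutations of the four positions; these three equations
  sort any index quadruple.\<close>

lemma symmetric_tensor_swap:
  assumes "symmetric_tensor A"
  shows "A$j$i$k$l = A$i$j$k$l" and "A$i$k$j$l = A$i$j$k$l" and "A$i$j$l$k = A$i$j$k$l"
proof -
  define f where "f = (\<lambda>n::nat. if n = 1 then i else if n = 2 then j else if n = 3 then k else l)"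
  have swap: "A $ f (\<sigma> 1) $ f (\<sigma> 2) $ f (\<sigma> 3) $ f (\<sigma> 4) = A$i$j$k$l"
    if "\<sigma> permutes {1..4}" for \<sigma>
  proof -
    have f4: "f 1 = i" "f 2 = j" "f 3 = k" "f 4 = l"
      by (simp_all add: f_def)
    have "A $ f (\<sigma> 1) $ f (\<sigma> 2) $ f (\<sigma> 3) $ f (\<sigma> 4) = A $ f 1 $ f 2 $ f 3 $ f 4"
      using assms that unfolding symmetric_tensor_def by blast
    then show ?thesis
      unfolding f4 .
  qed
  show "A$j$i$k$l = A$i$j$k$l"
    using swap[OF permutes_swap_id[of 1 _ 2]] by (simp add: f_def transpose_def)
  show "A$i$k$j$l = A$i$j$k$l"
    using swap[OF permutes_swap_id[of 2 _ 3]] by (simp add: f_def transpose_def)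
  show "A$i$j$l$k = A$i$j$k$l"
    using swap[OF permutes_swap_id[of 3 _ 4]] by (simp add: f_def transpose_def)
qed

lemma tensor_form_symmetric_3:
  fixes A :: "3 tensor4"
  assumes "symmetric_tensor A"
  shows "tensor_form A x =
      A$1$1$1$1 * x$1^4 + A$2$2$2$2 * x$2^4 + A$3$3$3$3 * x$3^4
    + 4 * (A$1$1$1$2 * x$1^3 * x$2 + A$1$1$1$3 * x$1^3 * x$3 + A$1$2$2$2 * x$1 * x$2^3
         + A$2$2$2$3 * x$2^3 * x$3 + A$1$3$3$3 * x$1 * x$3^3 + A$2$3$3$3 * x$2 * x$3^3)
    + 6 * (A$1$1$2$2 * x$1^2 * x$2^2 + A$1$1$3$3 * x$1^2 * x$3^2 + A$2$2$3$3 * x$2^2 * x$3^2)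
    + 12 * (A$1$1$2$3 * x$1^2 * x$2 * x$3 + A$1$2$2$3 * x$1 * x$2^2 * x$3
          + A$1$2$3$3 * x$1 * x$2 * x$3^2)"
  unfolding tensor_form_def sum_3
  by (simp add: symmetric_tensor_swap[OF assms] eval_nat_numeral algebra_simps)

lemma opposite_entries_3:
  fixes L U :: "3 tensor4"
  assumes "symmetric_tensor L" and "symmetric_tensor U"
    and "U$1$1$1$2 = - L$1$1$1$2" and "U$1$1$1$3 = - L$1$1$1$3" and "U$1$2$2$2 = - L$1$2$2$2"
    and "U$2$2$2$3 = - L$2$2$2$3" and "U$1$3$3$3 = - L$1$3$3$3" and "U$2$3$3$3 = - L$2$3$3$3"
    and "U$1$1$2$3 = - L$1$1$2$3" and "U$1$2$2$3 = - L$1$2$2$3" and "U$1$2$3$3 = - L$1$2$3$3"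
    and "\<not> paired i j k l"
  shows "U$i$j$k$l = - L$i$j$k$l"
proof -
  have "\<forall>i j k l. \<not> paired i j k l \<longrightarrow> U$i$j$k$l = - L$i$j$k$l"
    unfolding forall_3 paired_def
    using assms(3-11)
    by (simp add: symmetric_tensor_swap[OF assms(1)] symmetric_tensor_swap[OF assms(2)])
  then show ?thesis
    using assms(12) by blast
qed

section \<open>The two extremal quartics\<close>

text \<open>The quartic is invariant under the cyclic shift of the variables, so the squares are taken as one
  orbit of a single quadratic form. Its coefficients are chosen such that all monomials other than
  \<open>x\<^sup>4\<close> and \<open>x\<^sup>2 y\<^sup>2\<close> (up to shifts) match, and what is left over is a multiple of
  \<open>(x\<^sup>2 + y\<^sup>2 + z\<^sup>2)\<^sup>2\<close>.\<close>

lemma cyclic_quartic_pos: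
  fixes x y z :: real
  assumes "x \<noteq> 0 \<or> y \<noteq> 0 \<or> z \<noteq> 0"
  shows "0 < x^4 + y^4 + z^4 + 4 * (x^2 * y^2 + y^2 * z^2 + z^2 * x^2)
             - 4 * (x^3 * y + y^3 * z + z^3 * x)" (is "0 < ?f")
proof -
  have "35 * ?f = 2 * ((4 * x^2 - y^2 - 8 * x * y + 3 * y * z - 2 * z * x)^2
                     + (4 * y^2 - z^2 - 8 * y * z + 3 * z * x - 2 * x * y)^2
                     + (4 * z^2 - x^2 - 8 * z * x + 3 * x * y - 2 * y * z)^2)
                  + (x^2 + y^2 + z^2)^2"
    by algebra
  moreover have "0 < x^2 + y^2 + z^2"
    using assms by (elim disjE) (simp_all add: add_pos_nonneg add_nonneg_pos)
  ultimately show ?thesis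
    by (smt (verit) zero_le_power2 zero_less_power)
qed

text \<open>The squares come from completing the square in a positive definite Gram matrix of the quartic with
  respect to the six quadratic monomials. Hence they can only vanish simultaneously if all quadratic
  monomials do.\<close>

lemma noncyclic_quartic_pos:
  fixes x y z :: real
  assumes "x \<noteq> 0 \<or> y \<noteq> 0 \<or> z \<noteq> 0"
  shows "0 < x^4 + y^4 + z^4 + 6 * (x^2 * y^2 + y^2 * z^2 + z^2 * x^2)
             - 4 * (x^3 * y + y^3 * z) - 12 * x * y * z^2" (is "0 < ?f")
proof (rule ccontr)
  define a where "a = y^2 - 2 * y * z + z * x"
  define b where "b = y * z + x^2 / 6 - x * y / 2 - z * x"
  define c where "c = z^2 + 2 / 3 * x^2 - 2 * x * y"
  define d where "d = x^2 - x * y + 2 / 3 * z * x"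
  define e where "e = x * (y - z)"
  have "?f = a^2 + 2 * b^2 + c^2 + d^2 / 2 + e^2 + 4 / 9 * (z * x)^2"
    unfolding a_def b_def c_def d_def e_def
    by (simp add: field_simps eval_nat_numeral)
  moreover assume "\<not> 0 < ?f"
  ultimately have "a^2 + 2 * b^2 + c^2 + d^2 / 2 + e^2 + 4 / 9 * (z * x)^2 \<le> 0"
    by linarith
  then have "a^2 = 0" "c^2 = 0" "d^2 = 0" "e^2 = 0" "(z * x)^2 = 0"
    using zero_le_power2[of a] zero_le_power2[of b] zero_le_power2[of c] zero_le_power2[of d]
      zero_le_power2[of e] zero_le_power2[of "z * x"]
    by linarith+
  then have zero: "a = 0" "c = 0" "d = 0" "e = 0" "z * x = 0"
    by simp_all
  then have "x = 0"
    by (auto simp: d_def e_def)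
  moreover from this have "z = 0"
    using zero by (simp add: c_def)
  moreover from this \<open>x = 0\<close> have "y = 0"
    using zero by (simp add: a_def)
  ultimately show False
    using assms by simp
qed

section \<open>Positive definiteness of the interval tensor\<close>

theorem theorem5p4:
  fixes L U :: "3 tensor4"
  assumes "symmetric_tensor L" and "symmetric_tensor U" and "L \<le> U"
    and "L$1$1$1$1 = 1" and "L$2$2$2$2 = 1" and "L$3$3$3$3 = 1"
    and "L$1$2$2$2 = 0" and "L$2$3$3$3 = 0" and "L$1$1$1$3 = 0"
    and "U$1$2$2$2 = 0" and "U$2$3$3$3 = 0" and "U$1$1$1$3 = 0"
    and "L$1$1$1$2 = -1" and "L$2$2$2$3 = -1"
    and "U$1$1$1$2 = 1" and "U$2$2$2$3 = 1"
    and "((\<forall>i j k. i \<noteq> j \<and> i \<noteq> k \<and> j \<noteq> k \<longrightarrow>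
             L$i$i$j$j = 2/3 \<and> L$i$i$j$k = 0 \<and> U$i$i$j$k = 0) \<and>
          L$1$3$3$3 = -1 \<and> U$1$3$3$3 = 1)
       \<or> ((\<forall>i j. i \<noteq> j \<longrightarrow> L$i$i$j$j = 1) \<and>
          L$1$1$2$3 = 0 \<and> L$1$2$2$3 = 0 \<and> U$1$1$2$3 = 0 \<and> U$1$2$2$3 = 0 \<and>
          L$1$2$3$3 = -1 \<and> U$1$2$3$3 = 1 \<and>
          L$1$3$3$3 = 0 \<and> U$1$3$3$3 = 0)"
  shows "pos_def_interval_tensor {L..U}"
proof (rule pos_def_interval_if_lower_pos_def)
  note cond = assms(17)
  show "U$i$j$k$l = - L$i$j$k$l" if "\<not> paired i j k l" for i j k l
  proof -
    have distinct: "(1::3) \<noteq> 2" "(1::3) \<noteq> 3" "(2::3) \<noteq> 3"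
      by simp_all
    have "U$1$3$3$3 = - L$1$3$3$3"
      using cond by auto
    moreover have "U$1$1$2$3 = - L$1$1$2$3"
      using cond distinct by auto
    moreover have "U$1$2$2$3 = - L$1$2$2$3"
    proof -
      \<comment> \<open>Condition (a) speaks of this entry with its repeated index in front.\<close>
      have "L$1$2$2$3 = L$2$2$1$3" "U$1$2$2$3 = U$2$2$1$3"
        using symmetric_tensor_swap[OF assms(1)] symmetric_tensor_swap[OF assms(2)] by metis+
      then show ?thesis
        using cond distinct by auto
    qed
    moreover have "U$1$2$3$3 = - L$1$2$3$3"
    proof -
      have "L$1$2$3$3 = L$3$3$1$2" "U$1$2$3$3 = U$3$3$1$2"
        using symmetric_tensor_swap[OF assms(1)] symmetric_tensor_swap[OF assms(2)] by metis+
      then show ?thesis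
        using cond distinct by auto
    qed
    ultimately show ?thesis
      using opposite_entries_3[OF assms(1,2) _ _ _ _ _ _ _ _ _ that] assms(7-16) by simp
  qed
  show "pos_def_tensor L"
    unfolding pos_def_tensor_def
  proof (intro allI impI)
    fix x :: "real ^ 3"
    assume "x \<noteq> 0"
    then have x: "x$1 \<noteq> 0 \<or> x$2 \<noteq> 0 \<or> x$3 \<noteq> 0"
      by (simp add: vec_eq_iff forall_3)
    from cond show "0 < tensor_form L x"
    proof (elim disjE conjE)
      assume a: "\<forall>i j k. i \<noteq> j \<and> i \<noteq> k \<and> j \<noteq> k \<longrightarrow>
          L$i$i$j$j = 2/3 \<and> L$i$i$j$k = 0 \<and> U$i$i$j$k = 0" and "L$1$3$3$3 = -1"
      have entries: "L$1$1$2$2 = 2/3" "L$1$1$3$3 = 2/3" "L$2$2$3$3 = 2/3"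
        "L$1$1$2$3 = 0" "L$2$2$1$3 = 0" "L$3$3$1$2 = 0"
        using a[rule_format, of 1 2 3] a[rule_format, of 1 3 2] a[rule_format, of 2 3 1]
          a[rule_format, of 2 1 3] a[rule_format, of 3 1 2] by simp_all
      have "L$1$2$2$3 = L$2$2$1$3" "L$1$2$3$3 = L$3$3$1$2"
        using symmetric_tensor_swap[OF assms(1)] by metis+
      then show ?thesis
        using cyclic_quartic_pos[OF x] \<open>L$1$3$3$3 = -1\<close> assms(4-16)
        by (simp add: tensor_form_symmetric_3[OF assms(1)] entries algebra_simps)
    next
      assume b: "\<forall>i j. i \<noteq> j \<longrightarrow> L$i$i$j$j = 1"
        and "L$1$1$2$3 = 0" "L$1$2$2$3 = 0" "L$1$2$3$3 = -1" "L$1$3$3$3 = 0"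
      moreover have "L$1$1$2$2 = 1" "L$1$1$3$3 = 1" "L$2$2$3$3 = 1"
        using b by simp_all
      ultimately show ?thesis
        using noncyclic_quartic_pos[OF x] assms(4-16)
        by (simp add: tensor_form_symmetric_3[OF assms(1)] algebra_simps)
    qed
  qed
qed

end
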